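(* Every 1-counter language is context-free.
   Context: Let $\Sigma$ be a finite alphabet. A (non-deterministic) $\mathbb Z$-automaton over $\Sigma$ is a finite directed graph with a start vertex, some accept vertices, and edges labelled by elements of $(\Sigma\cup\{\epsilon\})\times\mathbb Z$, where $\epsilon$ is the empty word. It accepts $w\in\Sigma^*$ if there is a path from the start vertex to some accept vertex whose first label components concatenate to $w$ and whose second components sum to $0$ (the counter value may be negative along the way and is tested only at the end). A language is 1-counter if it is the set of words accepted by some $\mathbb Z$-automaton. A language is context-free if it is accepted by a (non-deterministic) pushdown automaton. *)

theory Defs
  imports Main
begin

text \<open>
  A symbol of \<open>\<Sigma> \<union> {\<epsilon>}\<close> is an element of \<open>'a option\<close>, with \<open>None\<close> standing for \<open>\<epsilon>\<close>.
\<close>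

definition symbol_word :: "'a option \<Rightarrow> 'a list" where
  "symbol_word x = (case x of None \<Rightarrow> [] | Some a \<Rightarrow> [a])"


subsection \<open>\<open>\<int>\<close>-automata\<close>

text \<open>
  An edge \<open>(u, x, n, v)\<close> goes from \<open>u\<close> to \<open>v\<close> and carries the label \<open>(x, n)\<close>.  Edges form a set:
  parallel edges are possible only with distinct labels, since a repeated label does not
  affect the accepted language.
\<close>

type_synonym ('q, 'a) zedge = "'q \<times> 'a option \<times> int \<times> 'q"

record ('q, 'a) zautomaton =
  vertices :: "'q set"
  start :: 'q
  accepting :: "'q set"
  edges :: "('q, 'a) zedge set"

definition is_zautomaton :: "'a set \<Rightarrow> ('q, 'a) zautomaton \<Rightarrow> bool" where
  "is_zautomaton \<Sigma> M \<longleftrightarrow>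
     finite (vertices M) \<and> start M \<in> vertices M \<and> accepting M \<subseteq> vertices M \<and>
     finite (edges M) \<and>
     (\<forall>(u, x, n, v) \<in> edges M. u \<in> vertices M \<and> set_option x \<subseteq> \<Sigma> \<and> v \<in> vertices M)"

fun zpath :: "('q, 'a) zautomaton \<Rightarrow> 'q \<Rightarrow> ('q, 'a) zedge list \<Rightarrow> 'q \<Rightarrow> bool" where
  "zpath M p [] q \<longleftrightarrow> p \<in> vertices M \<and> p = q"
| "zpath M p ((u, x, n, v) # es) q \<longleftrightarrow> (u, x, n, v) \<in> edges M \<and> u = p \<and> zpath M v es q"

definition zpath_word :: "('q, 'a) zedge list \<Rightarrow> 'a list" where
  "zpath_word es = concat (map (\<lambda>(u, x, n, v). symbol_word x) es)"

definition zpath_counter :: "('q, 'a) zedge list \<Rightarrow> int" where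
  "zpath_counter es = sum_list (map (\<lambda>(u, x, n, v). n) es)"

definition zlang :: "('q, 'a) zautomaton \<Rightarrow> 'a list set" where
  "zlang M = {w. \<exists>q \<in> accepting M. \<exists>es.
     zpath M (start M) es q \<and> zpath_word es = w \<and> zpath_counter es = 0}"

text \<open>
  A definition in HOL cannot quantify over the type of vertices, so vertices are taken to be natural
  numbers; by \<open>one_counter_language_zlang\<close> below this is no restriction.
\<close>

definition one_counter_language :: "'a set \<Rightarrow> 'a list set \<Rightarrow> bool" where
  "one_counter_language \<Sigma> L \<longleftrightarrow>
     (\<exists>M :: (nat, 'a) zautomaton. is_zautomaton \<Sigma> M \<and> L = zlang M)"


definition rename_zedge :: "('q \<Rightarrow> 'r) \<Rightarrow> ('q, 'a) zedge \<Rightarrow> ('r, 'a) zedge" where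
  "rename_zedge f = (\<lambda>(u, x, n, v). (f u, x, n, f v))"

definition rename_zautomaton ::
    "('q \<Rightarrow> 'r) \<Rightarrow> ('q, 'a) zautomaton \<Rightarrow> ('r, 'a) zautomaton" where
  "rename_zautomaton f M =
     \<lparr>vertices = f ` vertices M, start = f (start M), accepting = f ` accepting M,
      edges = rename_zedge f ` edges M\<rparr>"

lemma rename_zpath_labels:
  "zpath_word (map (rename_zedge f) es) = zpath_word es"
  "zpath_counter (map (rename_zedge f) es) = zpath_counter es"
  by (induction es) (auto simp: zpath_word_def zpath_counter_def rename_zedge_def)

lemma zpath_rename:
  "zpath M p es q \<Longrightarrow> zpath (rename_zautomaton f M) (f p) (map (rename_zedge f) es) (f q)"
  by (induction M p es q rule: zpath.induct)
     (force simp: rename_zautomaton_def rename_zedge_def)+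

lemma zpath_rename_inv:
  assumes "is_zautomaton \<Sigma> M" and "inj_on f (vertices M)"
    and "zpath (rename_zautomaton f M) p' es' q'" and "p \<in> vertices M" and "p' = f p"
  shows "\<exists>es q. q \<in> vertices M \<and> q' = f q \<and> zpath M p es q \<and> es' = map (rename_zedge f) es"
  using assms(3-)
proof (induction es' arbitrary: p p')
  case Nil
  then show ?case by (intro exI[of _ "[]"]) auto
next
  case (Cons e' es')
  obtain u' x n v' where e': "e' = (u', x, n, v')" by (cases e')
  with Cons.prems(1) have "e' \<in> rename_zedge f ` edges M" and u': "u' = p'"
    and rest: "zpath (rename_zautomaton f M) v' es' q'"
    by (auto simp: rename_zautomaton_def)
  then obtain u v where uv: "(u, x, n, v) \<in> edges M" "u' = f u" "v' = f v"
    using e' by (auto simp: rename_zedge_def)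
  have V: "u \<in> vertices M" "v \<in> vertices M"
    using assms(1) uv(1) by (auto simp: is_zautomaton_def)
  have "u = p"
    using assms(2) V(1) Cons.prems uv(2) u' by (auto dest: inj_onD)
  obtain es q where "q \<in> vertices M" "q' = f q" "zpath M v es q" "es' = map (rename_zedge f) es"
    using Cons.IH[OF rest V(2) uv(3)] by blast
  then show ?case
    using uv \<open>u = p\<close> e' by (intro exI[of _ "(u, x, n, v) # es"]) (auto simp: rename_zedge_def)
qed

lemma zlang_rename:
  assumes "is_zautomaton \<Sigma> M" and "inj_on f (vertices M)"
  shows "zlang (rename_zautomaton f M) = zlang M"
proof (intro set_eqI iffI)
  fix w assume "w \<in> zlang M"
  then obtain q es where "q \<in> accepting M" "zpath M (start M) es q" "zpath_word es = w"
    "zpath_counter es = 0"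
    by (auto simp: zlang_def)
  then show "w \<in> zlang (rename_zautomaton f M)"
    using zpath_rename[of M "start M" es q f] unfolding zlang_def
    by (auto simp: rename_zautomaton_def rename_zpath_labels intro!: exI[of _ "map (rename_zedge f) es"])
next
  fix w assume "w \<in> zlang (rename_zautomaton f M)"
  then obtain q es' where q: "q \<in> accepting M"
    and path: "zpath (rename_zautomaton f M) (f (start M)) es' (f q)"
    and lab: "zpath_word es' = w" "zpath_counter es' = 0"
    by (auto simp: zlang_def rename_zautomaton_def)
  have "start M \<in> vertices M" "q \<in> vertices M"
    using assms(1) q by (auto simp: is_zautomaton_def)
  moreover obtain es r where "r \<in> vertices M" "f q = f r" "zpath M (start M) es r"
    "es' = map (rename_zedge f) es"
    using zpath_rename_inv[OF assms path \<open>start M \<in> vertices M\<close> refl] by blast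
  moreover have "q = r"
    using assms(2) calculation by (auto dest: inj_onD)
  ultimately show "w \<in> zlang M"
    using q lab by (auto simp: zlang_def rename_zpath_labels)
qed

lemma is_zautomaton_rename:
  assumes "is_zautomaton \<Sigma> M"
  shows "is_zautomaton \<Sigma> (rename_zautomaton f M)"
  using assms by (fastforce simp: is_zautomaton_def rename_zautomaton_def rename_zedge_def)

lemma one_counter_language_zlang:
  fixes M :: "('q, 'a) zautomaton"
  assumes "is_zautomaton \<Sigma> M"
  shows "one_counter_language \<Sigma> (zlang M)"
proof -
  obtain f :: "'q \<Rightarrow> nat" where "inj_on f (vertices M)"
    using assms finite_imp_inj_to_nat_seg[of "vertices M"] by (auto simp: is_zautomaton_def)
  then show ?thesis
    using assms zlang_rename is_zautomaton_rename unfolding one_counter_language_def by metis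
qed


subsection \<open>Pushdown automata\<close>

text \<open>
  A move \<open>(p, x, Z, q, \<gamma>)\<close> leads from state \<open>p\<close> to state \<open>q\<close>, reads \<open>x\<close> and replaces the topmost
  stack symbol \<open>Z\<close> by the word \<open>\<gamma>\<close>; the top of the stack is the head of the list.  There is no move
  on an empty stack.
\<close>

type_synonym ('q, 'a, 's) pda_move = "'q \<times> 'a option \<times> 's \<times> 'q \<times> 's list"

record ('q, 'a, 's) pda =
  states :: "'q set"
  stack_symbols :: "'s set"
  init_state :: 'q
  init_symbol :: 's
  final_states :: "'q set"
  moves :: "('q, 'a, 's) pda_move set"

definition is_pda :: "'a set \<Rightarrow> ('q, 'a, 's) pda \<Rightarrow> bool" where
  "is_pda \<Sigma> P \<longleftrightarrow>
     finite (states P) \<and> finite (stack_symbols P) \<and>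
     init_state P \<in> states P \<and> init_symbol P \<in> stack_symbols P \<and> final_states P \<subseteq> states P \<and>
     finite (moves P) \<and>
     (\<forall>(p, x, Z, q, \<gamma>) \<in> moves P.
        p \<in> states P \<and> set_option x \<subseteq> \<Sigma> \<and> Z \<in> stack_symbols P \<and>
        q \<in> states P \<and> set \<gamma> \<subseteq> stack_symbols P)"

text \<open>A configuration consists of the state, the unread input and the stack.\<close>

type_synonym ('q, 'a, 's) pda_config = "'q \<times> 'a list \<times> 's list"

inductive pda_step ::
    "('q, 'a, 's) pda \<Rightarrow> ('q, 'a, 's) pda_config \<Rightarrow> ('q, 'a, 's) pda_config \<Rightarrow> bool"
  for P where
  "(p, x, Z, q, \<gamma>) \<in> moves P \<Longrightarrow>
     pda_step P (p, symbol_word x @ w, Z # \<beta>) (q, w, \<gamma> @ \<beta>)"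

text \<open>Acceptance is by final state, with arbitrary remaining stack content.\<close>

definition pda_lang :: "('q, 'a, 's) pda \<Rightarrow> 'a list set" where
  "pda_lang P = {w. \<exists>q \<in> final_states P. \<exists>\<beta>.
     (pda_step P)\<^sup>*\<^sup>* (init_state P, w, [init_symbol P]) (q, [], \<beta>)}"

text \<open>
  States and stack symbols are natural numbers for the same reason as above; the two sets are
  finite, so this is again no restriction.
\<close>

definition context_free_language :: "'a set \<Rightarrow> 'a list set \<Rightarrow> bool" where
  "context_free_language \<Sigma> L \<longleftrightarrow>
     (\<exists>P :: (nat, 'a, nat) pda. is_pda \<Sigma> P \<and> L = pda_lang P)"

end

theory Submission
  imports Defs
begin

text \<open>
  A pushdown automaton can store an integer in unary, as a stack of symbols \<open>1\<close> or of symbols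
  \<open>-1\<close> above a bottom marker, and it can test for zero by looking for the marker.
  The only obstacle is that an edge of a \<open>\<int>\<close>-automaton may change the counter by more than one.
  Therefore the pushdown automaton first keeps the label \<open>n\<close> of an edge as a residue in its finite
  control and then moves it to the stack one unit at a time, by \<open>\<epsilon>\<close>-moves.
  The labels are finitely many, so finitely many residues suffice.

  The counter value of the \<open>\<int>\<close>-automaton is at each moment the residue plus the sum of the
  stack symbols, the marker being the symbol \<open>0\<close>.  This invariant is preserved no matter how the
  automaton chooses between pushing and popping, so soundness does not depend on a
  disciplined use of the stack (\<open>represents_rtranclp\<close>).  For completeness it suffices to exhibit one
  good strategy: keep only symbols of one sign on the stack, and get rid of the whole residue
  before the next edge (\<open>flush_residue\<close>).

  The automaton is built over the state type that suits it, and transferred to natural numbers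
  by renaming (\<open>context_free_language_pda_lang\<close>).
\<close>


section \<open>Renaming the states and stack symbols of a pushdown automaton\<close>

definition rename_pda ::
    "('q \<Rightarrow> 'r) \<Rightarrow> ('s \<Rightarrow> 't) \<Rightarrow> ('q, 'a, 's) pda \<Rightarrow> ('r, 'a, 't) pda" where
  "rename_pda f g P =
     \<lparr>states = f ` states P, stack_symbols = g ` stack_symbols P,
      init_state = f (init_state P), init_symbol = g (init_symbol P),
      final_states = f ` final_states P,
      moves = (\<lambda>(p, x, Z, q, \<gamma>). (f p, x, g Z, f q, map g \<gamma>)) ` moves P\<rparr>"

definition rename_config ::
    "('q \<Rightarrow> 'r) \<Rightarrow> ('s \<Rightarrow> 't) \<Rightarrow> ('q, 'a, 's) pda_config \<Rightarrow> ('r, 'a, 't) pda_config" where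
  "rename_config f g = (\<lambda>(p, w, \<beta>). (f p, w, map g \<beta>))"

definition pda_configs :: "('q, 'a, 's) pda \<Rightarrow> ('q, 'a, 's) pda_config set" where
  "pda_configs P = {(p, w, \<beta>). p \<in> states P \<and> set \<beta> \<subseteq> stack_symbols P}"

lemma is_pda_rename:
  assumes "is_pda \<Sigma> P"
  shows "is_pda \<Sigma> (rename_pda f g P)"
  using assms unfolding is_pda_def rename_pda_def by (fastforce split: prod.splits)

lemma pda_step_rename:
  assumes "pda_step P c d"
  shows "pda_step (rename_pda f g P) (rename_config f g c) (rename_config f g d)"
  using assms
proof cases
  case (1 p x Z q \<gamma> w \<beta>)
  then have "(f p, x, g Z, f q, map g \<gamma>) \<in> moves (rename_pda f g P)"
    by (force simp: rename_pda_def)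
  from pda_step.intros[OF this, of w "map g \<beta>"] show ?thesis
    using 1 by (simp add: rename_config_def)
qed

text \<open>
  A renaming that is injective on the two finite sets only is reflected just for configurations
  over these sets; that is why their preservation is part of the conclusion.
\<close>

lemma pda_step_rename_inv:
  assumes P: "is_pda \<Sigma> P"
    and f: "inj_on f (states P)" and g: "inj_on g (stack_symbols P)"
    and c: "c \<in> pda_configs P"
    and step: "pda_step (rename_pda f g P) (rename_config f g c) d'"
  shows "\<exists>d \<in> pda_configs P. d' = rename_config f g d \<and> pda_step P c d"
  using step
proof cases
  case (1 p' x Z' q' \<gamma>' w \<beta>')
  then obtain p Z q \<gamma> where m: "(p, x, Z, q, \<gamma>) \<in> moves P"
    and eqs: "p' = f p" "Z' = g Z" "q' = f q" "\<gamma>' = map g \<gamma>"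
    by (auto simp: rename_pda_def)
  have wf: "p \<in> states P" "Z \<in> stack_symbols P" "q \<in> states P" "set \<gamma> \<subseteq> stack_symbols P"
    using P m by (auto simp: is_pda_def)
  obtain r v \<alpha> where r: "c = (r, v, \<alpha>)" by (cases c)
  with 1(1) eqs have c_eqs: "f r = f p" "v = symbol_word x @ w" "map g \<alpha> = g Z # \<beta>'"
    by (auto simp: rename_config_def)
  then obtain Y \<beta> where \<alpha>: "\<alpha> = Y # \<beta>" "g Y = g Z" "\<beta>' = map g \<beta>" by auto
  have "r = p" "Y = Z"
    using c r \<alpha> c_eqs wf by (auto simp: pda_configs_def intro: inj_onD[OF f] inj_onD[OF g])
  then have "pda_step P c (q, w, \<gamma> @ \<beta>)"
    using pda_step.intros[OF m] r \<alpha> c_eqs by simp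
  moreover have "(q, w, \<gamma> @ \<beta>) \<in> pda_configs P"
    using c r \<alpha> wf by (auto simp: pda_configs_def)
  moreover have "d' = rename_config f g (q, w, \<gamma> @ \<beta>)"
    using 1(2) eqs \<alpha> by (simp add: rename_config_def)
  ultimately show ?thesis by blast
qed

lemma rtranclp_pda_step_rename:
  assumes "(pda_step P)\<^sup>*\<^sup>* c d"
  shows "(pda_step (rename_pda f g P))\<^sup>*\<^sup>* (rename_config f g c) (rename_config f g d)"
  using assms by induction (auto intro: rtranclp.rtrancl_into_rtrancl pda_step_rename)

lemma rtranclp_pda_step_rename_inv:
  assumes P: "is_pda \<Sigma> P"
    and inj: "inj_on f (states P)" "inj_on g (stack_symbols P)"
    and c: "c \<in> pda_configs P"
    and steps: "(pda_step (rename_pda f g P))\<^sup>*\<^sup>* (rename_config f g c) d'"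
  shows "\<exists>d \<in> pda_configs P. d' = rename_config f g d \<and> (pda_step P)\<^sup>*\<^sup>* c d"
  using steps
proof induction
  case base
  then show ?case using c by blast
next
  case (step d' e')
  then show ?case
    using pda_step_rename_inv[OF P inj] by (metis rtranclp.rtrancl_into_rtrancl)
qed

lemma pda_lang_rename:
  assumes P: "is_pda \<Sigma> P"
    and f: "inj_on f (states P)" and g: "inj_on g (stack_symbols P)"
  shows "pda_lang (rename_pda f g P) = pda_lang P"
proof (intro set_eqI iffI)
  fix w assume "w \<in> pda_lang P"
  then obtain q \<beta> where "q \<in> final_states P"
    and run: "(pda_step P)\<^sup>*\<^sup>* (init_state P, w, [init_symbol P]) (q, [], \<beta>)"
    by (auto simp: pda_lang_def)
  then show "w \<in> pda_lang (rename_pda f g P)"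
    using rtranclp_pda_step_rename[OF run, of f g]
    by (auto simp: pda_lang_def rename_pda_def rename_config_def)
next
  let ?c = "\<lambda>w. (init_state P, w, [init_symbol P])"
  fix w assume "w \<in> pda_lang (rename_pda f g P)"
  then obtain q \<beta>' where q: "q \<in> final_states P"
    and run: "(pda_step (rename_pda f g P))\<^sup>*\<^sup>* (rename_config f g (?c w)) (f q, [], \<beta>')"
    by (auto simp: pda_lang_def rename_pda_def rename_config_def)
  have "?c w \<in> pda_configs P" and q_state: "q \<in> states P"
    using P q by (auto simp: is_pda_def pda_configs_def)
  from rtranclp_pda_step_rename_inv[OF P f g this(1) run]
  obtain r \<beta> where "r \<in> states P" "f q = f r" "(pda_step P)\<^sup>*\<^sup>* (?c w) (r, [], \<beta>)"
    by (auto simp: rename_config_def pda_configs_def)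
  moreover from this have "q = r" using f q_state by (auto dest: inj_onD)
  ultimately show "w \<in> pda_lang P" using q by (auto simp: pda_lang_def)
qed

lemma context_free_language_pda_lang:
  fixes P :: "('q, 'a, 's) pda"
  assumes P: "is_pda \<Sigma> P"
  shows "context_free_language \<Sigma> (pda_lang P)"
proof -
  obtain f :: "'q \<Rightarrow> nat" where f: "inj_on f (states P)"
    using P finite_imp_inj_to_nat_seg[of "states P"] by (auto simp: is_pda_def)
  obtain g :: "'s \<Rightarrow> nat" where g: "inj_on g (stack_symbols P)"
    using P finite_imp_inj_to_nat_seg[of "stack_symbols P"] by (auto simp: is_pda_def)
  show ?thesis
    unfolding context_free_language_def
    using is_pda_rename[OF P] pda_lang_rename[OF P f g] by metis
qed


section \<open>Paths of a \<open>\<int>\<close>-automaton\<close>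

lemma zpath_append:
  assumes "zpath M p es q" and "zpath M q fs r"
  shows "zpath M p (es @ fs) r"
  using assms by (induction M p es q rule: zpath.induct) auto

lemma zpath_word_simps [simp]:
  "zpath_word [] = []"
  "zpath_word ((u, x, n, v) # es) = symbol_word x @ zpath_word es"
  "zpath_word (es @ fs) = zpath_word es @ zpath_word fs"
  by (simp_all add: zpath_word_def)

lemma zpath_counter_simps [simp]:
  "zpath_counter [] = 0"
  "zpath_counter ((u, x, n, v) # es) = n + zpath_counter es"
  "zpath_counter (es @ fs) = zpath_counter es + zpath_counter fs"
  by (simp_all add: zpath_counter_def)


section \<open>The pushdown automaton of a \<open>\<int>\<close>-automaton\<close>

text \<open>
  The sum is a convenient upper bound for the absolute values of all labels.
\<close>

definition residues :: "('q, 'a) zautomaton \<Rightarrow> int set" where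
  "residues M = (let b = \<Sum>(u, x, n, v) \<in> edges M. \<bar>n\<bar> in {- b..b})"

lemma finite_residues: "finite (residues M)"
  by (simp add: residues_def Let_def)

lemma zero_in_residues: "0 \<in> residues M"
  by (auto simp: residues_def Let_def intro!: sum_nonneg)

lemma label_in_residues:
  assumes "finite (edges M)" and "(u, x, n, v) \<in> edges M"
  shows "n \<in> residues M"
proof -
  have "\<bar>n\<bar> \<le> (\<Sum>(u, x, n, v) \<in> edges M. \<bar>n\<bar>)"
    using member_le_sum[of "(u, x, n, v)" "edges M" "\<lambda>(u, x, n, v). \<bar>n\<bar>"] assms by auto
  then show ?thesis by (auto simp: residues_def Let_def)
qed

lemma residues_towards_zero:
  assumes "k \<in> residues M" and "k \<noteq> 0"
  shows "k - sgn k \<in> residues M"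
  using assms by (auto simp: residues_def Let_def sgn_if)

text \<open>
  A state \<open>Some (v, k)\<close> stands for the vertex \<open>v\<close> with residue \<open>k\<close>, and the symbol \<open>0\<close> is the
  bottom marker.  Acceptance by final state ignores the stack; the extra state \<open>None\<close> turns the
  zero test into a matter of the state.
\<close>

inductive counter_move ::
    "('q, 'a) zautomaton \<Rightarrow> ('q \<times> int) option \<Rightarrow> 'a option \<Rightarrow> int \<Rightarrow>
     ('q \<times> int) option \<Rightarrow> int list \<Rightarrow> bool"
  for M where
  follow: "(u, x, n, v) \<in> edges M \<Longrightarrow> Z \<in> {-1, 0, 1} \<Longrightarrow>
     counter_move M (Some (u, 0)) x Z (Some (v, n)) [Z]"
| push: "v \<in> vertices M \<Longrightarrow> k \<in> residues M \<Longrightarrow> k - s \<in> residues M \<Longrightarrow>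
     s \<in> {-1, 1} \<Longrightarrow> Z \<in> {-1, 0, 1} \<Longrightarrow>
     counter_move M (Some (v, k)) None Z (Some (v, k - s)) [s, Z]"
| pop: "v \<in> vertices M \<Longrightarrow> k \<in> residues M \<Longrightarrow> k + s \<in> residues M \<Longrightarrow> s \<in> {-1, 1} \<Longrightarrow>
     counter_move M (Some (v, k)) None s (Some (v, k + s)) []"
| accept: "q \<in> accepting M \<Longrightarrow> counter_move M (Some (q, 0)) None 0 None []"

definition counter_pda :: "('q, 'a) zautomaton \<Rightarrow> (('q \<times> int) option, 'a, int) pda" where
  "counter_pda M =
     \<lparr>states = insert None (Some ` (vertices M \<times> residues M)),
      stack_symbols = {-1, 0, 1},
      init_state = Some (start M, 0),
      init_symbol = 0,
      final_states = {None},
      moves = {(p, x, Z, q, \<gamma>). counter_move M p x Z q \<gamma>}\<rparr>"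

lemma counter_move_wf:
  assumes M: "is_zautomaton \<Sigma> M" and move: "counter_move M p x Z q \<gamma>"
  shows "p \<in> states (counter_pda M) \<and> q \<in> states (counter_pda M) \<and>
    Z \<in> stack_symbols (counter_pda M) \<and> set \<gamma> \<subseteq> stack_symbols (counter_pda M) \<and>
    length \<gamma> \<le> 2 \<and> x \<in> insert None ((\<lambda>(u, x, n, v). x) ` edges M) \<and> set_option x \<subseteq> \<Sigma>"
  using move
proof cases
  case (follow u n v)
  have "u \<in> vertices M" "v \<in> vertices M" "set_option x \<subseteq> \<Sigma>" "n \<in> residues M"
    using M follow label_in_residues[of M] by (auto simp: is_zautomaton_def)
  moreover have "x \<in> (\<lambda>(u, x, n, v). x) ` edges M"
    using follow by force
  ultimately show ?thesis
    using follow zero_in_residues[of M] by (auto simp: counter_pda_def)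
next
  case (accept r)
  then show ?thesis
    using M zero_in_residues[of M] by (auto simp: counter_pda_def is_zautomaton_def)
qed (auto simp: counter_pda_def)

lemma is_pda_counter_pda:
  assumes M: "is_zautomaton \<Sigma> M"
  shows "is_pda \<Sigma> (counter_pda M)"
proof -
  let ?P = "counter_pda M"
  have fin: "finite (states ?P)" "finite (stack_symbols ?P)"
    using M finite_residues[of M] by (auto simp: counter_pda_def is_zautomaton_def)
  have "moves ?P \<subseteq> states ?P \<times> insert None ((\<lambda>(u, x, n, v). x) ` edges M) \<times> stack_symbols ?P \<times>
      states ?P \<times> {\<gamma>. set \<gamma> \<subseteq> stack_symbols ?P \<and> length \<gamma> \<le> 2}"
  proof
    fix m assume "m \<in> moves ?P"
    then obtain p x Z q \<gamma> where m: "m = (p, x, Z, q, \<gamma>)" and "counter_move M p x Z q \<gamma>"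
      by (auto simp: counter_pda_def)
    from counter_move_wf[OF M this(2)] show "m \<in> states ?P \<times>
        insert None ((\<lambda>(u, x, n, v). x) ` edges M) \<times> stack_symbols ?P \<times>
        states ?P \<times> {\<gamma>. set \<gamma> \<subseteq> stack_symbols ?P \<and> length \<gamma> \<le> 2}"
      unfolding m by blast
  qed
  moreover have "finite (edges M)"
    using M by (simp add: is_zautomaton_def)
  ultimately have "finite (moves ?P)"
    using fin finite_lists_length_le[OF fin(2), of 2] by (auto elim!: finite_subset)
  moreover have "p \<in> states ?P \<and> set_option x \<subseteq> \<Sigma> \<and> Z \<in> stack_symbols ?P \<and>
      q \<in> states ?P \<and> set \<gamma> \<subseteq> stack_symbols ?P"
    if "(p, x, Z, q, \<gamma>) \<in> moves ?P" for p x Z q \<gamma>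
    using counter_move_wf[OF M, of p x Z q \<gamma>] that by (simp add: counter_pda_def)
  moreover have "init_state ?P \<in> states ?P" "init_symbol ?P \<in> stack_symbols ?P"
    "final_states ?P \<subseteq> states ?P"
    using M zero_in_residues[of M] by (auto simp: counter_pda_def is_zautomaton_def)
  ultimately show ?thesis
    using fin unfolding is_pda_def by blast
qed

lemma counter_pda_step:
  assumes "counter_move M p x Z q \<gamma>"
  shows "pda_step (counter_pda M) (p, symbol_word x @ w, Z # \<beta>) (q, w, \<gamma> @ \<beta>)"
  using assms by (auto intro!: pda_step.intros simp: counter_pda_def)

lemma counter_pda_stepE:
  assumes "pda_step (counter_pda M) c d"
  obtains p x Z q \<gamma> w \<beta> where
    "c = (p, symbol_word x @ w, Z # \<beta>)" "d = (q, w, \<gamma> @ \<beta>)" "counter_move M p x Z q \<gamma>"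
  using assms by (cases rule: pda_step.cases) (auto simp: counter_pda_def)


section \<open>Soundness\<close>

text \<open>
  The invariant of all computations on the input \<open>w\<close>.  That the marker occurs at the bottom only
  is what makes it a zero test: if it is on top, then the stack sum is \<open>0\<close>.
\<close>

fun represents ::
    "('q, 'a) zautomaton \<Rightarrow> 'a list \<Rightarrow> (('q \<times> int) option, 'a, int) pda_config \<Rightarrow> bool" where
  "represents M w (Some (v, k), w', \<beta>) \<longleftrightarrow>
     (\<exists>es. zpath M (start M) es v \<and> w = zpath_word es @ w' \<and>
       zpath_counter es = k + sum_list \<beta> \<and> (\<exists>\<beta>'. \<beta> = \<beta>' @ [0] \<and> 0 \<notin> set \<beta>'))"
| "represents M w (None, w', \<beta>) \<longleftrightarrow>
     (\<exists>es. \<exists>q \<in> accepting M. zpath M (start M) es q \<and> w = zpath_word es @ w' \<and>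
       zpath_counter es = 0)"

lemma bottom_marker_Cons:
  "(\<exists>\<beta>'. Z # \<beta> = \<beta>' @ [0] \<and> 0 \<notin> set \<beta>') \<longleftrightarrow>
     (if Z = 0 then \<beta> = [] else \<exists>\<beta>'. \<beta> = \<beta>' @ [0] \<and> 0 \<notin> set \<beta>')"
  for Z :: int
  by (auto simp: Cons_eq_append_conv)

lemma represents_step:
  assumes M: "is_zautomaton \<Sigma> M"
    and step: "pda_step (counter_pda M) c d" and c: "represents M w c"
  shows "represents M w d"
  using step
proof (rule counter_pda_stepE)
  fix p x Z q \<gamma> w' \<beta>
  assume eqs: "c = (p, symbol_word x @ w', Z # \<beta>)" "d = (q, w', \<gamma> @ \<beta>)"
  assume "counter_move M p x Z q \<gamma>"
  then show ?thesis
  proof cases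
    case (follow u n v)
    then obtain es where es: "zpath M (start M) es u" "w = zpath_word es @ symbol_word x @ w'"
      "zpath_counter es = sum_list (Z # \<beta>)" "\<exists>\<beta>'. Z # \<beta> = \<beta>' @ [0] \<and> 0 \<notin> set \<beta>'"
      using c eqs by auto
    have "zpath M u [(u, x, n, v)] v"
      using M follow by (auto simp: is_zautomaton_def)
    from zpath_append[OF es(1) this] show ?thesis
      using es(2-) follow eqs by (auto intro!: exI[of _ "es @ [(u, x, n, v)]"])
  next
    case (push v k s)
    then show ?thesis
      using c eqs by (auto simp: symbol_word_def bottom_marker_Cons)
  next
    case (pop v k)
    then show ?thesis
      using c eqs by (auto simp: symbol_word_def bottom_marker_Cons algebra_simps)
  next
    case (accept r)
    then show ?thesis
      using c eqs by (auto simp: symbol_word_def bottom_marker_Cons)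
  qed
qed

lemma represents_rtranclp:
  assumes M: "is_zautomaton \<Sigma> M"
    and "(pda_step (counter_pda M))\<^sup>*\<^sup>* c d" and "represents M w c"
  shows "represents M w d"
  using assms(2-) by induction (auto intro: represents_step[OF M])

lemma pda_lang_counter_pda_subset:
  assumes M: "is_zautomaton \<Sigma> M"
  shows "pda_lang (counter_pda M) \<subseteq> zlang M"
proof
  fix w assume "w \<in> pda_lang (counter_pda M)"
  then obtain \<beta> where run:
    "(pda_step (counter_pda M))\<^sup>*\<^sup>* (Some (start M, 0), w, [0]) (None, [], \<beta>)"
    by (auto simp: pda_lang_def counter_pda_def)
  have "represents M w (Some (start M, 0), w, [0])"
    using M by (auto simp: is_zautomaton_def intro!: exI[of _ "[]"])
  from represents_rtranclp[OF M run this] show "w \<in> zlang M"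
    by (auto simp: zlang_def)
qed


section \<open>Completeness\<close>

definition unary_stack :: "int \<Rightarrow> int list" where
  "unary_stack c = replicate (nat \<bar>c\<bar>) (sgn c) @ [0]"

lemma unary_stack_0 [simp]: "unary_stack 0 = [0]"
  by (simp add: unary_stack_def)

lemma unary_stack_away_from_zero:
  assumes "\<bar>s\<bar> = 1" and "s * c \<ge> 0"
  shows "unary_stack (c + s) = s # unary_stack c"
proof -
  have s: "s = 1 \<or> s = -1" using assms(1) by linarith
  then have "nat \<bar>c + s\<bar> = Suc (nat \<bar>c\<bar>)" and "sgn (c + s) = s" and "c = 0 \<or> sgn c = s"
    using assms(2) by (auto simp: sgn_if)
  then show ?thesis by (auto simp: unary_stack_def)
qed

lemma unary_stack_top:
  obtains Z \<beta> where "Z \<in> {-1, 0, 1}" "unary_stack c = Z # \<beta>"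
proof (cases "c = 0")
  case False
  have "unary_stack c = sgn c # unary_stack (c - sgn c)"
    using unary_stack_away_from_zero[of "sgn c" "c - sgn c"] False
    by (auto simp: sgn_if split: if_splits)
  then show ?thesis using that[of "sgn c"] by (auto simp: sgn_if)
qed (use that in simp)

text \<open>
  A unit \<open>s\<close> of the residue is pushed if the counter has the sign of \<open>s\<close> or is zero, and cancels
  the topmost stack symbol \<open>-s\<close> otherwise; in this way the stack remains unary.
\<close>

lemma shift_unit:
  assumes v: "v \<in> vertices M" and k: "k \<in> residues M" "k \<noteq> 0"
  shows "pda_step (counter_pda M)
    (Some (v, k), w, unary_stack c) (Some (v, k - sgn k), w, unary_stack (c + sgn k))"
proof (cases "sgn k * c \<ge> 0")
  case True
  obtain Z \<beta> where Z: "Z \<in> {-1, 0, 1}" "unary_stack c = Z # \<beta>"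
    by (rule unary_stack_top)
  have "counter_move M (Some (v, k)) None Z (Some (v, k - sgn k)) [sgn k, Z]"
    using v k residues_towards_zero[OF k] Z(1) by (intro counter_move.push) (auto simp: sgn_if)
  from counter_pda_step[OF this, of w \<beta>] show ?thesis
    using unary_stack_away_from_zero[of "sgn k" c] True k(2) Z(2)
    by (simp add: symbol_word_def abs_sgn_eq)
next
  case False
  then have "- sgn k * (c + sgn k) \<ge> 0"
    using k(2) by (auto simp: sgn_if split: if_splits)
  then have stack: "unary_stack c = - sgn k # unary_stack (c + sgn k)"
    using unary_stack_away_from_zero[of "- sgn k" "c + sgn k"] k(2) by (simp add: abs_sgn_eq)
  have "counter_move M (Some (v, k)) None (- sgn k) (Some (v, k + - sgn k)) []"
    using v k residues_towards_zero[OF k] by (intro counter_move.pop) (auto simp: sgn_if)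
  from counter_pda_step[OF this, of w "unary_stack (c + sgn k)"] show ?thesis
    using stack by (simp add: symbol_word_def)
qed

lemma flush_residue:
  assumes v: "v \<in> vertices M" and "k \<in> residues M"
  shows "(pda_step (counter_pda M))\<^sup>*\<^sup>*
    (Some (v, k), w, unary_stack c) (Some (v, 0), w, unary_stack (c + k))"
  using assms(2)
proof (induction "nat \<bar>k\<bar>" arbitrary: k c rule: less_induct)
  case less
  show ?case
  proof (cases "k = 0")
    case False
    then have "nat \<bar>k - sgn k\<bar> < nat \<bar>k\<bar>" by (auto simp: sgn_if)
    from less.hyps[OF this residues_towards_zero[OF less.prems False], of "c + sgn k"]
    show ?thesis
      using shift_unit[OF v less.prems False, of w c]
      by (simp add: converse_rtranclp_into_rtranclp)
  qed simp
qed

lemma counter_pda_zpath: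
  assumes M: "is_zautomaton \<Sigma> M" and "zpath M p es q"
  shows "(pda_step (counter_pda M))\<^sup>*\<^sup>*
    (Some (p, 0), zpath_word es @ w, unary_stack c)
    (Some (q, 0), w, unary_stack (c + zpath_counter es))"
  using assms(2)
proof (induction es arbitrary: p c)
  case (Cons e es)
  obtain x n v where e: "e = (p, x, n, v)" and edge: "(p, x, n, v) \<in> edges M"
    and rest: "zpath M v es q"
    using Cons.prems by (cases e) auto
  have v: "v \<in> vertices M" and n: "n \<in> residues M"
    using M edge label_in_residues[of M] by (auto simp: is_zautomaton_def)
  obtain Z \<beta> where Z: "Z \<in> {-1, 0, 1}" "unary_stack c = Z # \<beta>"
    by (rule unary_stack_top)
  have "pda_step (counter_pda M)
      (Some (p, 0), zpath_word (e # es) @ w, unary_stack c)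
      (Some (v, n), zpath_word es @ w, unary_stack c)"
    using counter_pda_step[OF counter_move.follow[OF edge Z(1)], of "zpath_word es @ w" \<beta>]
    by (simp add: e Z(2))
  also have "(pda_step (counter_pda M))\<^sup>*\<^sup>* \<dots>
      (Some (v, 0), zpath_word es @ w, unary_stack (c + n))"
    by (rule flush_residue[OF v n])
  also have "(pda_step (counter_pda M))\<^sup>*\<^sup>* \<dots>
      (Some (q, 0), w, unary_stack (c + zpath_counter (e # es)))"
    using Cons.IH[OF rest, of "c + n"] by (simp add: e add.assoc)
  finally show ?case .
qed simp

lemma zlang_subset_pda_lang_counter_pda:
  assumes M: "is_zautomaton \<Sigma> M"
  shows "zlang M \<subseteq> pda_lang (counter_pda M)"
proof
  fix w assume "w \<in> zlang M"
  then obtain q es where q: "q \<in> accepting M" and path: "zpath M (start M) es q"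
    and "zpath_word es = w" "zpath_counter es = 0"
    by (auto simp: zlang_def)
  then have "(pda_step (counter_pda M))\<^sup>*\<^sup>* (Some (start M, 0), w, [0]) (Some (q, 0), [], [0])"
    using counter_pda_zpath[OF M path, of "[]" 0] by simp
  also have "pda_step (counter_pda M) \<dots> (None, [], [])"
    using counter_pda_step[OF counter_move.accept[OF q], of "[]" "[]"]
    by (simp add: symbol_word_def)
  finally show "w \<in> pda_lang (counter_pda M)"
    by (auto simp: pda_lang_def counter_pda_def)
qed


section \<open>One-counter languages are context-free\<close>

theorem lemma1:
  fixes \<Sigma> :: "'a set" and L :: "'a list set"
  assumes "finite \<Sigma>"
    and "one_counter_language \<Sigma> L"
  shows "context_free_language \<Sigma> L"
proof -
  obtain M :: "(nat, 'a) zautomaton" where M: "is_zautomaton \<Sigma> M" and L: "L = zlang M"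
    using assms(2) by (auto simp: one_counter_language_def)
  have "L = pda_lang (counter_pda M)"
    using pda_lang_counter_pda_subset[OF M] zlang_subset_pda_lang_counter_pda[OF M] L by blast
  then show ?thesis
    using context_free_language_pda_lang[OF is_pda_counter_pda[OF M]] by simp
qed

end
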